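(* Let $R\ge 1$ be an integer, let $N=R$ if $R$ is even and $N=R+1$ if $R$ is odd. In the $2N$ real variables $x_0,\dots,x_{2N-1}$ define the $N\times N$ block diagonal design $$C_N(x)=\mathrm{diag}\{D_0,D_1,\dots,D_{N/2-1}\},\qquad D_m=\begin{bmatrix} x_{4m}+\mathrm{i}x_{4m+1} & -x_{4m+2}+\mathrm{i}x_{4m+3}\\ x_{4m+2}+\mathrm{i}x_{4m+3} & x_{4m}-\mathrm{i}x_{4m+1}\end{bmatrix},$$ and let $C_P(x)$ be the $N\times R$ matrix consisting of the first $R$ columns of $C_N(x)$ (so $C_P=C_N$ if $R$ is even, and the last column is dropped if $R$ is odd). For $l=0,1,2,3$ let group $l$ be the set of the $N/2$ variables $x_k$ with $k\equiv l \pmod 4$. Let the vector of the variables in each group take values in a finite set $\mathcal{A}_l\subset\mathbb{R}^{N/2}$ which is a subset of a full-diversity rotated $\mathbb{Z}^{N/2}$ lattice, the four groups taking values independently of each other (so the information symbol vector ranges over all of $\mathcal{A}_0\times\mathcal{A}_1\times\mathcal{A}_2\times\mathcal{A}_3$). Then $C_P$ has the following properties. (1) (Rate one.) $C_P$ carries $N$ complex (i.e. $2N$ real) information variables in $N$ channel uses. (2) (Full diversity.) For any two distinct information vectors $x\neq x'$ in the signal set, the difference matrix $\Delta C_P=C_P(x)-C_P(x')$ has rank $R$, i.e. $\det\big((\Delta C_P)^H\Delta C_P\big)\neq 0$. (3) ($4$-group ML decodability.) $C_P$ is $4$-group ML decodable with respect to the four groups above: writing $C_P(x)=\sum_{k=0}^{2N-1}x_kW_k$,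 one has $W_j^HW_k+W_k^HW_j=\mathbf{0}$ whenever $j\not\equiv k\pmod 4$. (4) (Decodability is retained after whitening.) Let $M_1,\dots,M_R\in\mathbb{C}^{N\times N}$ be the relay matrices of $C_P$. For every $c>0$ and all $g_1,\dots,g_R\in\mathbb{C}$, with $\Omega=I_N+c\sum_{j=1}^{R}|g_j|^2M_jM_j^H$, the design $\Omega^{-1/2}C_P$ is also $4$-group ML decodable with respect to the same four groups: $(\Omega^{-1/2}W_j)^H(\Omega^{-1/2}W_k)+(\Omega^{-1/2}W_k)^H(\Omega^{-1/2}W_j)=\mathbf{0}$ whenever $j\not\equiv k\pmod 4$.
   Context: $\mathrm{i}=\sqrt{-1}$; $(\cdot)^H$ is the conjugate transpose, $(\cdot)^*$ the entrywise complex conjugate. A linear dispersion space-time block code in real variables $x_k$ is a matrix $S(x)=\sum_k x_kA_k$ with $A_k$ complex matrices, called the weight matrices. It is called $g$-group ML decodable (with respect to a partition of the variables into $g$ groups taking values independently of each other) if $A_j^HA_k+A_k^HA_j=\mathbf{0}$ whenever $x_j,x_k$ belong to different groups. A full-diversity rotated $\mathbb{Z}^n$ lattice is a set $\{Uz: z\in\mathbb{Z}^n\}$ with $U$ a real orthogonal $n\times n$ matrix such that every nonzero element of the set has all of its $n$ coordinates nonzero. Relay matrices: let $z\in\mathbb{C}^{N}$ be the vector with entries $z_{2m+1}=x_{4m}+\mathrm{i}x_{4m+1}$ and $z_{2m+2}=x_{4m+2}+\mathrm{i}x_{4m+3}$ for $m=0,\dots,N/2-1$. Each column $j$ of $C_P$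 is of the form $M_jz$ (if $j$ is odd) or $M_jz^*$ (if $j$ is even) for a unique matrix $M_j\in\mathbb{C}^{N\times N}$; $M_j$ is called the relay matrix of the $j$-th relay. In the two-phase amplify-and-forward relay network, $\Omega$ is the covariance, conditional on the relay-to-destination gains $g_j$, of the noise at the destination in the cooperation phase (unit variance destination noise plus forwarded relay noise), and multiplication by $\Omega^{-1/2}$ is the whitening filter. *)

theory Defs
  imports
    Complex_Main
    "Jordan_Normal_Form.Schur_Decomposition"
    "Jordan_Normal_Form.DL_Rank"
begin

text \<open>
  Matrices and vectors are those of Jordan_Normal_Form: their dimensions are values, rows, columns,
  variables and relays are indexed from 0, and \<^const>\<open>mat_adjoint\<close> is the conjugate transpose.
\<close>

subsection \<open>Matrix preliminaries\<close>

definition mat_sum :: "nat \<Rightarrow> nat \<Rightarrow> nat \<Rightarrow> (nat \<Rightarrow> complex mat) \<Rightarrow> complex mat" where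
  "mat_sum nr nc K A = mat nr nc (\<lambda>(i, j). \<Sum>k<K. A k $$ (i, j))"

text \<open>The quadratic form of a Hermitian matrix is real, so \<^const>\<open>Re\<close> discards nothing below.\<close>

definition hermitian_pos_def :: "nat \<Rightarrow> complex mat \<Rightarrow> bool" where
  "hermitian_pos_def n A \<longleftrightarrow>
     A \<in> carrier_mat n n \<and> mat_adjoint A = A \<and>
     (\<forall>v \<in> carrier_vec n. v \<noteq> 0\<^sub>v n \<longrightarrow> 0 < Re ((A *\<^sub>v v) \<bullet>c v))"

text \<open>The power \<open>-1/2\<close> of a Hermitian positive definite matrix; unspecified for other matrices.\<close>

definition inv_sqrt_mat :: "nat \<Rightarrow> complex mat \<Rightarrow> complex mat" where
  "inv_sqrt_mat n A = (THE B. hermitian_pos_def n B \<and> (B * B) * A = 1\<^sub>m n)"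

subsection \<open>Linear dispersion codes\<close>

text \<open>A design maps the vector of the \<open>K\<close> real variables to a \<open>T \<times> nt\<close> matrix, where \<open>T\<close> is the
  number of channel uses.\<close>

type_synonym design = "real vec \<Rightarrow> complex mat"

definition weight_matrices ::
  "nat \<Rightarrow> nat \<Rightarrow> nat \<Rightarrow> design \<Rightarrow> (nat \<Rightarrow> complex mat) \<Rightarrow> bool" where
  "weight_matrices T nt K S A \<longleftrightarrow>
     (\<forall>k<K. A k \<in> carrier_mat T nt) \<and>
     (\<forall>x \<in> carrier_vec K. S x = mat_sum T nt K (\<lambda>k. complex_of_real (x $ k) \<cdot>\<^sub>m A k))"

text \<open>The partition of the variables into \<open>g\<close> groups is given by the map \<open>grp\<close> that sends the
  index of a variable to the number of its group.\<close>

definition group_ML_decodable ::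
  "nat \<Rightarrow> nat \<Rightarrow> nat \<Rightarrow> nat \<Rightarrow> (nat \<Rightarrow> nat) \<Rightarrow> design \<Rightarrow> (nat \<Rightarrow> complex mat) \<Rightarrow> bool" where
  "group_ML_decodable T nt K g grp S A \<longleftrightarrow>
     grp ` {..<K} = {..<g} \<and>
     weight_matrices T nt K S A \<and>
     (\<forall>j<K. \<forall>k<K. grp j \<noteq> grp k \<longrightarrow>
        mat_adjoint (A j) * A k + mat_adjoint (A k) * A j = 0\<^sub>m nt nt)"

text \<open>The rate counts complex variables (half the number of real ones) per channel use. That the
  design actually carries its variables means that they can be recovered from the code matrix.\<close>

definition has_rate :: "nat \<Rightarrow> nat \<Rightarrow> nat \<Rightarrow> design \<Rightarrow> real \<Rightarrow> bool" where
  "has_rate T nt K S r \<longleftrightarrow>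
     (\<forall>x \<in> carrier_vec K. S x \<in> carrier_mat T nt) \<and>
     inj_on S (carrier_vec K) \<and>
     r = (real K / 2) / real T"

subsection \<open>Full-diversity rotated integer lattices\<close>

text \<open>The library's \<^const>\<open>orthogonal_mat\<close> does not require the columns to have norm 1.\<close>

definition full_div_rotated_Zn :: "nat \<Rightarrow> real vec set \<Rightarrow> bool" where
  "full_div_rotated_Zn n L \<longleftrightarrow>
     (\<exists>U \<in> carrier_mat n n.
        transpose_mat U * U = 1\<^sub>m n \<and>
        L = {U *\<^sub>v map_vec real_of_int z | z. z \<in> carrier_vec n}) \<and>
     (\<forall>v \<in> L. v \<noteq> 0\<^sub>v n \<longrightarrow> (\<forall>i<n. v $ i \<noteq> 0))"

subsection \<open>The code\<close>

definition code_len :: "nat \<Rightarrow> nat" where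
  "code_len R = (if even R then R else R + 1)"

definition D_block :: "real vec \<Rightarrow> nat \<Rightarrow> complex mat" where
  "D_block x m = mat_of_rows_list 2
     [[complex_of_real (x $ (4*m)) + \<i> * complex_of_real (x $ (4*m+1)),
       - complex_of_real (x $ (4*m+2)) + \<i> * complex_of_real (x $ (4*m+3))],
      [complex_of_real (x $ (4*m+2)) + \<i> * complex_of_real (x $ (4*m+3)),
       complex_of_real (x $ (4*m)) - \<i> * complex_of_real (x $ (4*m+1))]]"

definition C_full :: "nat \<Rightarrow> design" where
  "C_full N x = diag_block_mat (map (D_block x) [0..<N div 2])"

definition C_P :: "nat \<Rightarrow> design" where
  "C_P R x = mat (code_len R) R (\<lambda>(i, j). C_full (code_len R) x $$ (i, j))"

definition group_vec :: "nat \<Rightarrow> nat \<Rightarrow> real vec \<Rightarrow> real vec" where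
  "group_vec N l x = vec (N div 2) (\<lambda>m. x $ (4*m + l))"

definition signal_set :: "nat \<Rightarrow> (nat \<Rightarrow> real vec set) \<Rightarrow> real vec set" where
  "signal_set N \<A> = {x \<in> carrier_vec (2*N). \<forall>l<4. group_vec N l x \<in> \<A> l}"

subsection \<open>Relay matrices and noise covariance\<close>

text \<open>Entries \<open>2m\<close> and \<open>2m+1\<close> are \<open>x\<^bsub>4m\<^esub> + \<i> x\<^bsub>4m+1\<^esub>\<close> and \<open>x\<^bsub>4m+2\<^esub> + \<i> x\<^bsub>4m+3\<^esub>\<close>.\<close>

definition z_vec :: "nat \<Rightarrow> real vec \<Rightarrow> complex vec" where
  "z_vec N x = vec N (\<lambda>i. complex_of_real (x $ (2*i)) + \<i> * complex_of_real (x $ (2*i+1)))"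

text \<open>Columns are counted from 0, so it is the odd ones that use the conjugated vector.\<close>

definition is_relay_matrix :: "nat \<Rightarrow> nat \<Rightarrow> complex mat \<Rightarrow> bool" where
  "is_relay_matrix R j M \<longleftrightarrow>
     M \<in> carrier_mat (code_len R) (code_len R) \<and>
     (\<forall>x \<in> carrier_vec (2 * code_len R).
        col (C_P R x) j =
          M *\<^sub>v (if even j then z_vec (code_len R) x else conjugate (z_vec (code_len R) x)))"

definition relay_matrix :: "nat \<Rightarrow> nat \<Rightarrow> complex mat" where
  "relay_matrix R j = (THE M. is_relay_matrix R j M)"

definition noise_cov ::
  "nat \<Rightarrow> nat \<Rightarrow> (nat \<Rightarrow> complex mat) \<Rightarrow> real \<Rightarrow> (nat \<Rightarrow> complex) \<Rightarrow> complex mat" where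
  "noise_cov N R M c g =
     1\<^sub>m N + complex_of_real c \<cdot>\<^sub>m
       mat_sum N N R (\<lambda>j. complex_of_real ((cmod (g j))\<^sup>2) \<cdot>\<^sub>m (M j * mat_adjoint (M j)))"

end

theory Submission
  imports Defs
begin

text \<open>
  Up to scaling by a real diagonal matrix that is constant on the \<open>2 \<times> 2\<close> blocks, everything follows
  from one polarised Alamouti identity: \<open>S(x)\<^sup>H S(y) + S(y)\<^sup>H S(x)\<close> is diagonal, with entries
  proportional to the inner products of the coordinates of \<open>x\<close> and \<open>y\<close> in the blocks. On two different
  unit vectors these vanish (decodability). For \<open>x = y\<close> a nonzero difference of signals they are
  positive in every block, because a nonzero vector of the rotated lattice has no zero coordinate (full
  diversity). Finally \<open>M\<^sub>j M\<^sub>j\<^sup>H\<close> is the projection onto the block of relay \<open>j\<close>, so the noise covariance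
  is diagonal and constant on the blocks, and so is its inverse square root.
\<close>

subsection \<open>Matrices\<close>

lemma mat_adjoint_carrier [simp]: "A \<in> carrier_mat n m \<Longrightarrow> mat_adjoint A \<in> carrier_mat m n"
  unfolding mat_adjoint_def by (auto simp: mat_of_rows_def)

lemma mat_adjoint_dim [simp]:
  "dim_row (mat_adjoint A) = dim_col A" "dim_col (mat_adjoint A) = dim_row A"
  unfolding mat_adjoint_def by (auto simp: mat_of_rows_def)

lemma mat_adjoint_index [simp]:
  "i < dim_col A \<Longrightarrow> j < dim_row A \<Longrightarrow> mat_adjoint A $$ (i, j) = conjugate (A $$ (j, i))"
  unfolding mat_adjoint_def by (simp add: mat_of_rows_index)

lemma index_adjoint_mult:
  assumes "A \<in> carrier_mat n m" "B \<in> carrier_mat n m" "p < m" "q < m"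
  shows "(mat_adjoint A * B) $$ (p, q) = (\<Sum>i<n. conjugate (A $$ (i, p)) * B $$ (i, q))"
  using assms by (auto simp: scalar_prod_def lessThan_atLeast0 intro!: sum.cong)

text \<open>With equal block sizes the quotient by \<open>b\<close> names the block and the
  remainder the position in it. Peeling off the head block lowers indices by \<open>b\<close>, hence
  the quotient by one, and keeps remainders.\<close>

lemma diag_block_mat_index:
  assumes "\<And>A. A \<in> set As \<Longrightarrow> A \<in> carrier_mat b b" "i < b * length As" "j < b * length As"
  shows "diag_block_mat As $$ (i, j) =
    (if i div b = j div b then As ! (i div b) $$ (i mod b, j mod b) else 0)"
  using assms
proof (induction As arbitrary: i j)
  case Nil
  then show ?case by simp
next
  case (Cons A As)
  have b: "b > 0" using Cons.prems(2) by (cases b) auto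
  have A: "dim_row A = b" "dim_col A = b" using Cons.prems(1)[of A] by auto
  have "map dim_row As = map (\<lambda>_. b) As" "map dim_col As = map (\<lambda>_. b) As"
    using Cons.prems(1) by auto
  then have dims: "dim_row (diag_block_mat As) = b * length As"
      "dim_col (diag_block_mat As) = b * length As"
    by (simp_all only: dim_diag_block_mat sum_list_triv) (simp_all add: mult.commute)
  have IH: "diag_block_mat As $$ (i - b, j - b) =
    (if (i - b) div b = (j - b) div b then As ! ((i - b) div b) $$ ((i - b) mod b, (j - b) mod b) else 0)"
    if "i \<ge> b" "j \<ge> b"
    using Cons.prems that by (intro Cons.IH) auto
  have shift: "k div b = Suc ((k - b) div b)" "(k - b) mod b = k mod b" if "k \<ge> b" for k
    using that b by (simp_all add: le_div_geq le_mod_geq)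
  show ?case
    using Cons.prems(2,3) b
    by (cases "i < b"; cases "j < b") (auto simp: Let_def A dims IH shift)
qed

subsection \<open>The Gram matrix of the code\<close>

text \<open>The coordinates of \<open>z_vec\<close>, written with \<open>Complex\<close> so that
  real and imaginary parts simplify at once.\<close>

definition zc :: "real vec \<Rightarrow> nat \<Rightarrow> complex" where
  "zc x i = Complex (x $ (2*i)) (x $ (2*i+1))"

lemma zc_even: "zc x (2*m) = Complex (x $ (4*m)) (x $ (4*m+1))"
  by (simp add: zc_def mult.assoc[symmetric])

lemma zc_odd: "zc x (2*m+1) = Complex (x $ (4*m+2)) (x $ (4*m+3))"
proof -
  have "2 * (2*m+1) = 4*m+2" "2 * (2*m+1) + 1 = 4*m+3" by simp_all
  then show ?thesis unfolding zc_def by (simp only:)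
qed

lemma even_code_len: "even (code_len R)"
  by (simp add: code_len_def)

lemma le_code_len: "R \<le> code_len R"
  by (simp add: code_len_def)

lemma C_P_carrier [simp]: "C_P R x \<in> carrier_mat (code_len R) R"
  by (simp add: C_P_def)

text \<open>The second column of an Alamouti block is the first one conjugated and swapped, with a
  sign in the upper row. All later computations with entries start from this form.\<close>

lemma C_P_index:
  assumes "i < code_len R" "j < R"
  shows "C_P R x $$ (i, j) =
    (if i div 2 \<noteq> j div 2 then 0
     else if even j then zc x i
     else if even i then - cnj (zc x (i + 1)) else cnj (zc x (i - 1)))"
proof -
  let ?N = "code_len R"
  have j: "j < ?N" using assms(2) le_code_len[of R] by simp
  have "2 * (?N div 2) = ?N" using even_code_len by simp
  then have "C_P R x $$ (i, j) =
     (if i div 2 \<noteq> j div 2 then 0 else D_block x (i div 2) $$ (i mod 2, j mod 2))"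
    using assms j unfolding C_P_def C_full_def
    by (subst index_mat(1), simp, simp, simp only: prod.case, subst diag_block_mat_index[where b = 2])
       (auto simp: D_block_def mat_of_rows_list_def)
  moreover have "D_block x (i div 2) $$ (i mod 2, j mod 2) =
     (if even j then zc x i
     else if even i then - cnj (zc x (i + 1)) else cnj (zc x (i - 1)))"
  proof -
    have parity: "k mod 2 = (if even k then 0 else 1)" for k :: nat
      by presburger
    show ?thesis
    proof (cases "even i")
      case True
      then obtain m where "i = 2*m" by (elim evenE)
      then show ?thesis
        unfolding parity
        by (auto simp: D_block_def mat_of_rows_list_def complex_eq_iff zc_even zc_odd
            simp del: add_Suc_right One_nat_def)
    next
      case False
      then obtain m where "i = 2*m+1" by (elim oddE)
      then show ?thesis
        unfolding parity
        by (auto simp: D_block_def mat_of_rows_list_def complex_eq_iff zc_even zc_odd[simplified])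
    qed
  qed
  ultimately show ?thesis by (simp only:)
qed

lemma sum_block2:
  fixes f :: "nat \<Rightarrow> 'a::comm_monoid_add"
  assumes "even N" "2 * m < N" "\<And>i. i < N \<Longrightarrow> i div 2 \<noteq> m \<Longrightarrow> f i = 0"
  shows "(\<Sum>i<N. f i) = f (2*m) + f (2*m+1)"
proof -
  have "2*m+1 < N" using assms(1,2) by presburger
  then have "(\<Sum>i<N. f i) = (\<Sum>i\<in>{2*m, 2*m+1}. f i)"
  proof (intro sum.mono_neutral_right ballI)
    fix i assume "i \<in> {..<N} - {2*m, 2*m+1}"
    then have "i < N" "i div 2 \<noteq> m" by auto
    then show "f i = 0" by (rule assms(3))
  qed (use assms(2) in auto)
  then show ?thesis by simp
qed

definition block_inner :: "real vec \<Rightarrow> real vec \<Rightarrow> nat \<Rightarrow> real" where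
  "block_inner x y m = (\<Sum>l<4. x $ (4*m+l) * y $ (4*m+l))"

lemma block_inner_zc:
  "block_inner x y m =
    Re (cnj (zc x (2*m)) * zc y (2*m) + cnj (zc x (2*m+1)) * zc y (2*m+1))"
proof -
  have "(\<Sum>l<4. f l) = f 0 + f 1 + f 2 + f 3" for f :: "nat \<Rightarrow> real"
    by (simp add: eval_nat_numeral)
  then show ?thesis unfolding block_inner_def zc_even zc_odd by simp
qed

text \<open>The polarised Alamouti identity. Columns of different blocks have disjoint supports;
  inside a block the mixed terms cancel after symmetrising, provided that both rows carry the same
  scale. Constant \<open>d\<close> gives the code itself, a varying \<open>d\<close> its whitened
  version.\<close>

lemma C_P_gram:
  fixes d :: "nat \<Rightarrow> real" and R :: nat
  assumes d: "\<And>m. d (2*m) = d (2*m+1)"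
  defines "S \<equiv> \<lambda>x. mat_diag (code_len R) (\<lambda>i. complex_of_real (d i)) * C_P R x"
  shows "mat_adjoint (S x) * S y + mat_adjoint (S y) * S x =
    mat_diag R (\<lambda>p. complex_of_real (2 * (d p)\<^sup>2 * block_inner x y (p div 2)))"
proof (rule eq_matI)
  let ?N = "code_len R"
  let ?D = "mat_diag R (\<lambda>p. complex_of_real (2 * (d p)\<^sup>2 * block_inner x y (p div 2)))"
  have S: "S x \<in> carrier_mat ?N R" for x
    unfolding S_def by (rule mult_carrier_mat[OF mat_diag_dim C_P_carrier])
  show "dim_row (mat_adjoint (S x) * S y + mat_adjoint (S y) * S x) = dim_row ?D"
    "dim_col (mat_adjoint (S x) * S y + mat_adjoint (S y) * S x) = dim_col ?D"
    using S by (auto simp: mat_diag_def)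
  fix p q
  assume "p < dim_row ?D" "q < dim_col ?D"
  then have pq: "p < R" "q < R" by (auto simp: mat_diag_def)
  have Si: "S x $$ (i, j) = d i * C_P R x $$ (i, j)" if "i < ?N" "j < R" for x i j
    unfolding S_def using that by (simp add: mat_diag_mult_left[OF C_P_carrier])
  define f where "f i = cnj (d i * C_P R x $$ (i, p)) * (d i * C_P R y $$ (i, q))
      + cnj (d i * C_P R y $$ (i, p)) * (d i * C_P R x $$ (i, q))" for i
  have "(mat_adjoint (S x) * S y + mat_adjoint (S y) * S x) $$ (p, q) = (\<Sum>i<?N. f i)"
    using pq S[of x] S[of y]
    by (simp add: index_adjoint_mult[OF S S] Si f_def sum.distrib del: index_mult_mat(1))
  also define m where "m = p div 2"
  have m: "2 * m < ?N" using pq(1) le_code_len[of R] unfolding m_def by linarith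
  \<comment> \<open>Row \<open>2*m+1\<close> exists even when odd \<open>R\<close> has removed the
    column with that index, because the code length is even.\<close>
  then have m1: "2 * m + 1 < ?N" using even_code_len[of R] by presburger
  have "(\<Sum>i<?N. f i) = f (2*m) + f (2*m+1)"
    using pq by (intro sum_block2 even_code_len m) (auto simp: f_def C_P_index m_def)
  also have "\<dots> = ?D $$ (p, q)"
  proof (cases "q div 2 = m")
    case False
    then have "p \<noteq> q" by (auto simp: m_def)
    with False show ?thesis
      using pq m m1 by (simp add: f_def C_P_index mat_diag_def)
  next
    case True
    \<comment> \<open>Four entries remain inside one block. The hypothesis on \<open>d\<close>
      enters here: it lets the contributions of the two rows cancel off the diagonal and combine on
      it.\<close>
    consider "p = 2*m" "q = 2*m" | "p = 2*m" "q = 2*m+1" | "p = 2*m+1" "q = 2*m" | "p = 2*m+1" "q = 2*m+1"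
      using True m_def by (metis add.commute div_mult_mod_eq mult.commute parity_cases add_0)
    then show ?thesis
      using pq m m1 d[of m]
      by cases (simp_all add: f_def C_P_index mat_diag_def block_inner_zc complex_eq_iff
          power2_eq_square algebra_simps)
  qed
  finally show "(mat_adjoint (S x) * S y + mat_adjoint (S y) * S x) $$ (p, q) = ?D $$ (p, q)" .
qed

section \<open>Real linearity of the code and group decodability\<close>

lemma zc_linear:
  assumes "x \<in> carrier_vec (2*N)" "i < N"
  shows "zc x i = (\<Sum>k<2*N. complex_of_real (x $ k) * zc (unit_vec (2*N) k) i)"
proof -
  have "Re (zc (unit_vec (2*N) k) i) = of_bool (k = 2*i)"
    "Im (zc (unit_vec (2*N) k) i) = of_bool (k = 2*i+1)" if "k < 2*N" for k
    using assms(2) that by (auto simp: zc_def)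
  moreover have "(\<Sum>k<2*N. x $ k * of_bool (k = a)) = x $ a" if "a < 2*N" for a
    using that by (simp add: of_bool_def if_distrib[where f = "\<lambda>u. _ * u"] cong: if_cong)
  ultimately show ?thesis
    using assms(2) by (simp add: complex_eq_iff) (simp add: zc_def)
qed

text \<open>Conjugation in the odd columns does no harm, since the coefficients are real. The values
  of the code at unit vectors are therefore its weight matrices.\<close>

lemma C_P_linear:
  assumes x: "x \<in> carrier_vec (2 * code_len R)" and ij: "i < code_len R" "j < R"
  shows "C_P R x $$ (i, j) =
    (\<Sum>k<2 * code_len R. complex_of_real (x $ k) * C_P R (unit_vec (2 * code_len R) k) $$ (i, j))"
proof -
  \<comment> \<open>An entry in an even row may refer to the coordinate of the partner row
    \<open>i + 1\<close>.\<close>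
  have "i + 1 < code_len R" if "even i"
    using that ij(1) even_code_len[of R] by presburger
  then show ?thesis
    using ij
    by (simp add: C_P_index zc_linear[OF x] sum_negf)
qed

lemma zc_diff:
  assumes "x \<in> carrier_vec (2*N)" "y \<in> carrier_vec (2*N)" "i < N"
  shows "zc (x - y) i = zc x i - zc y i"
  using assms by (auto simp: complex_eq_iff zc_def)

text \<open>Turns a difference of codewords into a value of the code, to which the Gram identity
  applies.\<close>

lemma C_P_diff:
  assumes x: "x \<in> carrier_vec (2 * code_len R)" and y: "y \<in> carrier_vec (2 * code_len R)"
  shows "C_P R x - C_P R y = C_P R (x - y)"
proof (rule eq_matI)
  fix i j assume "i < dim_row (C_P R (x - y))" "j < dim_col (C_P R (x - y))"
  then have ij: "i < code_len R" "j < R" by (auto simp: C_P_def)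
  then have "i + 1 < code_len R" if "even i"
    using that even_code_len[of R] by presburger
  then show "(C_P R x - C_P R y) $$ (i, j) = C_P R (x - y) $$ (i, j)"
    using ij carrier_matD[OF C_P_carrier[of R y]] carrier_matD[OF C_P_carrier[of R x]]
    by (simp add: C_P_index zc_diff[OF x y])
qed (auto simp: C_P_def)

text \<open>Serves both decodability claims: \<open>d = 1\<close> for the code, and the inverse
  square roots of the noise variances for the whitened code.\<close>

lemma group_ML_decodable_scaled_C_P:
  fixes d :: "nat \<Rightarrow> real" and R :: nat
  assumes R: "R \<ge> 1" and d: "\<And>m. d (2*m) = d (2*m+1)"
  defines "N \<equiv> code_len R"
  defines "D \<equiv> mat_diag N (\<lambda>i. complex_of_real (d i))"
  shows "group_ML_decodable N R (2*N) 4 (\<lambda>k. k mod 4)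
    (\<lambda>x. D * C_P R x) (\<lambda>k. D * C_P R (unit_vec (2*N) k))"
  unfolding group_ML_decodable_def
proof (intro conjI allI impI)
  \<comment> \<open>There are at least four variables, so none of the four groups is empty.\<close>
  have N: "N \<ge> 2" using R by (auto simp: N_def code_len_def)
  show "(\<lambda>k. k mod 4) ` {..<2*N} = {..<4}"
  proof
    show "{..<4} \<subseteq> (\<lambda>k. k mod 4) ` {..<2*N}"
    proof
      fix l :: nat assume "l \<in> {..<4}"
      then have "l = l mod 4" "l \<in> {..<2*N}" using N by auto
      then show "l \<in> (\<lambda>k. k mod 4) ` {..<2*N}" by (rule image_eqI)
    qed
  qed auto
next
  have D: "D * C_P R x \<in> carrier_mat N R" for x
    unfolding D_def N_def by (rule mult_carrier_mat[OF mat_diag_dim C_P_carrier])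
  show "weight_matrices N R (2*N) (\<lambda>x. D * C_P R x) (\<lambda>k. D * C_P R (unit_vec (2*N) k))"
    unfolding weight_matrices_def
  proof (intro conjI ballI allI impI D)
    fix x :: "real vec" assume x: "x \<in> carrier_vec (2*N)"
    show "D * C_P R x =
      mat_sum N R (2*N) (\<lambda>k. complex_of_real (x $ k) \<cdot>\<^sub>m (D * C_P R (unit_vec (2*N) k)))"
      (is "_ = ?S")
    proof (rule eq_matI)
      fix i j assume "i < dim_row ?S" "j < dim_col ?S"
      then have ij: "i < code_len R" "j < R" by (auto simp: mat_sum_def N_def)
      then show "(D * C_P R x) $$ (i, j) = ?S $$ (i, j)"
        using C_P_linear[OF x[unfolded N_def] ij] carrier_matD[OF C_P_carrier]
        by (simp add: D_def mat_sum_def N_def mat_diag_mult_left[OF C_P_carrier] sum_distrib_left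
            mult.left_commute)
    qed (use D[of x] in \<open>auto simp: mat_sum_def\<close>)
  qed
next
  fix j k assume jk: "j < 2*N" "k < 2*N" "j mod 4 \<noteq> k mod 4"
  \<comment> \<open>Different residues force \<open>j \<noteq> k\<close>, and two different unit
    vectors share no nonzero coordinate.\<close>
  have "block_inner (unit_vec (2*N) j) (unit_vec (2*N) k) (p div 2) = 0" if "p < R" for p
  proof -
    obtain n where n: "N = 2 * n"
      using even_code_len[of R] unfolding N_def by (elim evenE)
    then have "p div 2 < n" using that le_code_len[of R] by (simp add: N_def)
    \<comment> \<open>Entries of a unit vector are specified only below its dimension.\<close>
    then have "4 * (p div 2) + l < 2 * N" if "l < 4" for l
      using that n by linarith
    then show ?thesis
      using jk unfolding block_inner_def by (intro sum.neutral) (auto simp: unit_vec_def)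
  qed
  then show "mat_adjoint (D * C_P R (unit_vec (2*N) j)) * (D * C_P R (unit_vec (2*N) k))
    + mat_adjoint (D * C_P R (unit_vec (2*N) k)) * (D * C_P R (unit_vec (2*N) j)) = 0\<^sub>m R R"
    unfolding D_def N_def C_P_gram[OF d]
    by (intro eq_matI) (auto simp: mat_diag_def)
qed

subsection \<open>Relay matrices and noise covariance\<close>

text \<open>Relay \<open>j\<close> permutes the coordinates inside its block by \<^term>\<open>relay_perm j\<close>, up to sign.\<close>

definition relay_perm :: "nat \<Rightarrow> nat \<Rightarrow> nat" where
  "relay_perm j a = (if even j then a else if even a then a + 1 else a - 1)"

definition relay_sgn :: "nat \<Rightarrow> nat \<Rightarrow> complex" where
  "relay_sgn j a = (if odd j \<and> even a then -1 else 1)"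

text \<open>A signed partial permutation matrix, whose rows outside the block of relay
  \<open>j\<close> vanish.\<close>

definition relay_entry :: "nat \<Rightarrow> nat \<Rightarrow> nat \<Rightarrow> complex" where
  "relay_entry j a b =
    (if b = relay_perm j a then if a div 2 = j div 2 then relay_sgn j a else 0 else 0)"

lemma relay_perm_less: "even N \<Longrightarrow> a < N \<Longrightarrow> relay_perm j a < N"
  unfolding relay_perm_def by presburger

lemma relay_perm_eq_iff [simp]: "relay_perm j a = relay_perm j b \<longleftrightarrow> a = b"
  unfolding relay_perm_def by presburger

lemma sum_relay_entry:
  assumes "even N" "a < N"
  shows "(\<Sum>b<N. relay_entry j a b * f b) =
    (if a div 2 = j div 2 then relay_sgn j a * f (relay_perm j a) else 0)"
proof -
  have "(\<Sum>b<N. relay_entry j a b * f b) = (\<Sum>b<N. if b = relay_perm j a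
      then (if a div 2 = j div 2 then relay_sgn j a * f (relay_perm j a) else 0) else 0)"
    by (intro sum.cong) (auto simp: relay_entry_def)
  then show ?thesis
    using relay_perm_less[OF assms, of j] by simp
qed

text \<open>The existence half of the description defining \<open>relay_matrix\<close>: the
  permutation and the sign are read off from \<open>C_P_index\<close>.\<close>

lemma is_relay_matrix_relay_entry:
  assumes j: "j < R"
  shows "is_relay_matrix R j (mat (code_len R) (code_len R) (\<lambda>(a, b). relay_entry j a b))"
  unfolding is_relay_matrix_def
proof (intro conjI ballI)
  let ?N = "code_len R"
  let ?M = "mat ?N ?N (\<lambda>(a, b). relay_entry j a b)"
  fix x :: "real vec" assume "x \<in> carrier_vec (2 * ?N)"
  let ?w = "if even j then z_vec ?N x else conjugate (z_vec ?N x)"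
  show "col (C_P R x) j = ?M *\<^sub>v ?w"
  proof (rule eq_vecI)
    fix a assume "a < dim_vec (?M *\<^sub>v ?w)"
    then have a: "a < ?N" by simp
    have z: "z_vec ?N x $ b = zc x b" if "b < ?N" for b
      using that by (simp add: z_vec_def zc_def complex_eq_iff)
    have w: "dim_vec ?w = ?N" by (simp add: z_vec_def)
    have wi: "?w $ b = (if even j then zc x b else cnj (zc x b))" if "b < ?N" for b
      using z[OF that] that by (simp add: z_vec_def)
    have "(?M *\<^sub>v ?w) $ a = (\<Sum>b<?N. relay_entry j a b * (if even j then zc x b else cnj (zc x b)))"
      using a w wi
      by (simp add: scalar_prod_def lessThan_atLeast0 del: if_split)
    also have "\<dots> = C_P R x $$ (a, j)"
      using a j
      by (auto simp: sum_relay_entry[OF even_code_len] C_P_index relay_sgn_def relay_perm_def)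
    finally show "col (C_P R x) j $ a = (?M *\<^sub>v ?w) $ a"
      using a j carrier_matD[OF C_P_carrier[of R x]] by simp
  qed (use carrier_matD[OF C_P_carrier[of R x]] in simp)
qed simp

lemma mult_mat_unit_vec:
  fixes A :: "'a :: semiring_1 mat"
  assumes "A \<in> carrier_mat n m" "j < m"
  shows "A *\<^sub>v unit_vec m j = col A j"
  using assms by (intro eq_vecI) (auto simp: scalar_prod_right_unit)

text \<open>The input with a single 1 at position \<open>2*b\<close> produces the unit vector
  \<open>b\<close>. It is real, so conjugation leaves it alone, and for either parity of
  \<open>j\<close> the code column equals column \<open>b\<close> of the relay matrix.\<close>

lemma is_relay_matrix_unique:
  assumes M: "is_relay_matrix R j M" and M': "is_relay_matrix R j M'"
  shows "M = M'"
proof (rule mat_col_eqI)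
  let ?N = "code_len R"
  have carr: "M \<in> carrier_mat ?N ?N" "M' \<in> carrier_mat ?N ?N"
    using M M' by (auto simp: is_relay_matrix_def)
  fix b assume "b < dim_col M'"
  then have b: "b < ?N" using carr by auto
  have z: "z_vec ?N (unit_vec (2 * ?N) (2*b)) = unit_vec ?N b"
  proof (rule eq_vecI)
    fix i assume "i < dim_vec (unit_vec ?N b :: complex vec)"
    then have "i < ?N" "2 * i + 1 \<noteq> 2 * b" by (simp, presburger)
    then show "z_vec ?N (unit_vec (2 * ?N) (2*b)) $ i = unit_vec ?N b $ i"
      using b by (simp add: z_vec_def)
  qed (simp add: z_vec_def)
  have c: "conjugate (unit_vec ?N b :: complex vec) = unit_vec ?N b"
    by (intro eq_vecI) (auto simp: unit_vec_def)
  let ?x = "unit_vec (2 * ?N) (2*b) :: real vec"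
  have "col (C_P R ?x) j = K *\<^sub>v unit_vec ?N b" if "is_relay_matrix R j K" for K
  proof -
    have "col (C_P R ?x) j = K *\<^sub>v (if even j then z_vec ?N ?x else conjugate (z_vec ?N ?x))"
      using that unit_vec_carrier unfolding is_relay_matrix_def by blast
    then show ?thesis by (simp only: z c if_cancel)
  qed
  from this[OF M] this[OF M'] have "M *\<^sub>v unit_vec ?N b = M' *\<^sub>v unit_vec ?N b" by simp
  then show "col M b = col M' b"
    by (simp only: mult_mat_unit_vec[OF carr(1) b] mult_mat_unit_vec[OF carr(2) b])
qed (use assms in \<open>auto simp: is_relay_matrix_def\<close>)

lemma relay_matrix_eq:
  assumes "j < R"
  shows "relay_matrix R j = mat (code_len R) (code_len R) (\<lambda>(a, b). relay_entry j a b)"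
  unfolding relay_matrix_def
  using is_relay_matrix_relay_entry[OF assms] is_relay_matrix_unique by blast

text \<open>The rows in the block are distinct unit vectors up to sign, the others are zero, and
  signs square to 1.\<close>

lemma relay_matrix_gram:
  assumes j: "j < R"
  shows "relay_matrix R j * mat_adjoint (relay_matrix R j) =
    mat_diag (code_len R) (\<lambda>a. if a div 2 = j div 2 then 1 else 0)"
proof (rule eq_matI)
  let ?N = "code_len R"
  let ?D = "mat_diag ?N (\<lambda>a. if a div 2 = j div 2 then 1 else 0 :: complex)"
  fix a b assume "a < dim_row ?D" "b < dim_col ?D"
  then have ab: "a < ?N" "b < ?N" by (auto simp: mat_diag_def)
  have "(relay_matrix R j * mat_adjoint (relay_matrix R j)) $$ (a, b) =
      (\<Sum>k<?N. relay_entry j a k * cnj (relay_entry j b k))"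
    using ab by (simp add: relay_matrix_eq[OF j] scalar_prod_def lessThan_atLeast0)
  also have "\<dots> = (if a = b \<and> a div 2 = j div 2 then 1 else 0)"
    unfolding sum_relay_entry[OF even_code_len ab(1)]
    by (auto simp: relay_entry_def relay_sgn_def)
  finally show "(relay_matrix R j * mat_adjoint (relay_matrix R j)) $$ (a, b) = ?D $$ (a, b)"
    using ab by (auto simp: mat_diag_def)
qed (auto simp: relay_matrix_eq[OF j] mat_diag_def)

text \<open>It depends on \<open>i\<close> only through the block \<open>i div 2\<close>, as the
  scaling in \<open>C_P_gram\<close> demands.\<close>

definition noise_var :: "nat \<Rightarrow> real \<Rightarrow> (nat \<Rightarrow> complex) \<Rightarrow> nat \<Rightarrow> real" where
  "noise_var R c g i = 1 + c * (\<Sum>j<R. if i div 2 = j div 2 then (cmod (g j))\<^sup>2 else 0)"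

lemma noise_cov_relay_matrix:
  "noise_cov (code_len R) R (relay_matrix R) c g =
    mat_diag (code_len R) (\<lambda>i. complex_of_real (noise_var R c g i))"
  unfolding noise_cov_def
  by (rule eq_matI)
     (auto simp: mat_sum_def relay_matrix_gram mat_diag_def noise_var_def intro!: sum.cong)

lemma noise_var_pos: "c > 0 \<Longrightarrow> noise_var R c g i > 0"
  unfolding noise_var_def by (intro add_pos_nonneg mult_nonneg_nonneg sum_nonneg) auto


subsection \<open>The inverse square root of a diagonal matrix\<close>

lemma Re_cscalar_prod_self_nonneg: "0 \<le> Re (v \<bullet>c v)" for v :: "complex vec"
  using conjugate_square_ge_0_vec[of v] by (simp add: less_eq_complex_def)

lemma hermitian_pos_def_mat_diag:
  assumes "\<And>i. i < n \<Longrightarrow> d i > 0"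
  shows "hermitian_pos_def n (mat_diag n (\<lambda>i. complex_of_real (d i)))"
  unfolding hermitian_pos_def_def
proof (intro conjI ballI impI)
  let ?D = "mat_diag n (\<lambda>i. complex_of_real (d i))"
  show "?D \<in> carrier_mat n n" by simp
  show "mat_adjoint ?D = ?D" by (rule eq_matI) (auto simp: mat_diag_def)
  fix v :: "complex vec" assume v: "v \<in> carrier_vec n" "v \<noteq> 0\<^sub>v n"
  then obtain k where k: "k < n" "v $ k \<noteq> 0" by (metis carrier_vecD eq_vecI index_zero_vec)
  have "(?D *\<^sub>v v) $ i = d i * v $ i" if "i < n" for i
    using that v(1)
    by (simp add: mat_diag_def scalar_prod_def if_distrib[where f = "\<lambda>u. u * _"] cong: if_cong)
  then have "Re ((?D *\<^sub>v v) \<bullet>c v) = (\<Sum>i<n. d i * (cmod (v $ i))\<^sup>2)"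
    using v(1)
    by (simp add: scalar_prod_def lessThan_atLeast0 complex_norm_square[symmetric]
        mult.assoc flip: of_real_power of_real_mult)
  also have "\<dots> > 0"
    using assms k by (intro sum_pos2[of _ k]) (simp_all add: assms less_imp_le)
  finally show "0 < Re ((?D *\<^sub>v v) \<bullet>c v)" .
qed

text \<open>With \<open>X = B - D\<close>, the equation \<open>B\<^sup>2 = D\<^sup>2\<close> reads \<open>B X + X D = 0\<close>. Hence every column \<open>v\<close> of
  \<open>X\<close> satisfies \<open>B v = - d\<^sub>j v\<close> with \<open>d\<^sub>j > 0\<close>, which positive definiteness forbids unless \<open>v = 0\<close>.\<close>

lemma pos_def_square_eq_mat_diag:
  assumes B: "hermitian_pos_def n B" and d: "\<And>i. i < n \<Longrightarrow> d i > 0"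
  defines "D \<equiv> mat_diag n (\<lambda>i. complex_of_real (d i))"
  assumes eq: "B * B = D * D"
  shows "B = D"
proof -
  have cB [simp]: "B \<in> carrier_mat n n" using B by (simp add: hermitian_pos_def_def)
  have cD [simp]: "D \<in> carrier_mat n n" by (simp add: D_def)
  define X where "X = B - D"
  have cX [simp]: "X \<in> carrier_mat n n" by (simp add: X_def minus_carrier_mat)
  have BX: "B * X = B * B - B * D" and XD: "X * D = B * D - D * D"
    unfolding X_def
    by (rule mult_minus_distrib_mat[OF cB cB cD], rule minus_mult_distrib_mat[OF cB cD cD])
  have "Q - P = - (P - Q)"
    if "P \<in> carrier_mat n n" "Q \<in> carrier_mat n n" for P Q :: "complex mat"
    using that by (intro eq_matI) auto
  then have sum0: "B * X = - (X * D)"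
    unfolding BX XD eq by (meson cB cD mult_carrier_mat)
  have zero: "col X j = 0\<^sub>v n" if j: "j < n" for j
  proof (rule ccontr)
    assume nz: "col X j \<noteq> 0\<^sub>v n"
    have cv: "col X j \<in> carrier_vec n" by (metis carrier_matD(1)[OF cX] col_dim)
    have "B *\<^sub>v col X j = col (B * X) j" by (rule col_mult2[OF cB cX j, symmetric])
    also have "\<dots> = (- complex_of_real (d j)) \<cdot>\<^sub>v col X j"
      unfolding sum0 D_def mat_diag_mult_right[OF cX]
      using j carrier_matD[OF cX] by (intro eq_vecI) auto
    finally have "(B *\<^sub>v col X j) \<bullet>c col X j = (- complex_of_real (d j)) * (col X j \<bullet>c col X j)"
      using cv by simp
    then have "Re ((B *\<^sub>v col X j) \<bullet>c col X j) = - d j * Re (col X j \<bullet>c col X j)"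
      by simp
    moreover have "\<dots> \<le> 0"
      using d[OF j] Re_cscalar_prod_self_nonneg[of "col X j"] by simp
    ultimately show False
      using B cv nz unfolding hermitian_pos_def_def by fastforce
  qed
  show ?thesis
  proof (rule mat_col_eqI)
    fix j assume "j < dim_col D"
    then have j: "j < n" using cD by auto
    show "col B j = col D j"
    proof (rule eq_vecI)
      fix i assume "i < dim_vec (col D j)"
      then have i: "i < n" using carrier_matD[OF cD] by simp
      have "X $$ (i, j) = 0"
        using zero[OF j] i j by (metis carrier_matD cX index_col index_zero_vec(1))
      then show "col B j $ i = col D j $ i"
        using i j carrier_matD[OF cB] carrier_matD[OF cD] by (simp add: X_def)
    qed (use carrier_matD[OF cB] carrier_matD[OF cD] in simp)
  qed (use carrier_matD[OF cB] carrier_matD[OF cD] in auto)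
qed

lemma inv_sqrt_mat_diag:
  assumes w: "\<And>i. i < n \<Longrightarrow> w i > 0"
  shows "inv_sqrt_mat n (mat_diag n (\<lambda>i. complex_of_real (w i))) =
    mat_diag n (\<lambda>i. complex_of_real (1 / sqrt (w i)))"
  unfolding inv_sqrt_mat_def
proof (rule the_equality)
  let ?W = "mat_diag n (\<lambda>i. complex_of_real (w i))"
  let ?D = "mat_diag n (\<lambda>i. complex_of_real (1 / sqrt (w i)))"
  have d: "1 / sqrt (w i) > 0" if "i < n" for i using w[OF that] by simp
  have wd: "complex_of_real (w i) * (complex_of_real (1 / sqrt (w i)))\<^sup>2 = 1" if "i < n" for i
    using w[OF that] by (simp add: of_real_power[symmetric] power_divide del: of_real_power)
  have inv: "?W * (?D * ?D) = 1\<^sub>m n" "(?D * ?D) * ?W = 1\<^sub>m n"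
    unfolding mat_diag_diag
    by (rule eq_matI; use wd in \<open>auto simp: mat_diag_def power2_eq_square mult.commute\<close>)+
  then show "hermitian_pos_def n ?D \<and> ?D * ?D * ?W = 1\<^sub>m n"
    using hermitian_pos_def_mat_diag[of n "\<lambda>i. 1 / sqrt (w i)"] d by simp
  fix B assume B: "hermitian_pos_def n B \<and> B * B * ?W = 1\<^sub>m n"
  then have cB: "B \<in> carrier_mat n n" by (simp add: hermitian_pos_def_def)
  \<comment> \<open>Both squares are left inverses of \<open>?W\<close>, hence equal; uniqueness of
    the positive root then follows from \<open>pos_def_square_eq_mat_diag\<close>.\<close>
  have "B * B = B * B * (?W * (?D * ?D))" using cB inv by simp
  also have "\<dots> = B * B * ?W * (?D * ?D)"
    using cB by (intro assoc_mult_mat[symmetric, of _ n n _ n _ n]) auto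
  also have "\<dots> = 1\<^sub>m n * (?D * ?D)" using B by (simp only:)
  also have "\<dots> = ?D * ?D" by (intro left_mult_one_mat[of _ n n] mult_carrier_mat[of _ n n] mat_diag_dim)
  finally have "B * B = ?D * ?D" .
  then show "B = ?D"
    using B d by (intro pos_def_square_eq_mat_diag) auto
qed

subsection \<open>Full diversity\<close>

lemma det_mat_diag: "det (mat_diag n f) = (\<Prod>i<n. f i)"
  by (subst det_upper_triangular[of _ n])
     (auto simp: mat_diag_def prod_list_diag_prod lessThan_atLeast0)

text \<open>A kernel vector of \<open>A\<close> is one of its Gram matrix, so the kernel is trivial
  and the columns are independent.\<close>

lemma rank_eq_dim_col_of_det_gram:
  fixes A :: "complex mat"
  assumes A: "A \<in> carrier_mat n m" and det: "det (mat_adjoint A * A) \<noteq> 0"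
  shows "vec_space.rank n A = m"
proof -
  have ker: "v = 0\<^sub>v m" if v: "v \<in> carrier_vec m" and Av: "A *\<^sub>v v = 0\<^sub>v n" for v
  proof -
    have "(mat_adjoint A * A) *\<^sub>v v = mat_adjoint A *\<^sub>v (A *\<^sub>v v)"
      using A v by (intro assoc_mult_mat_vec[of _ m n _ m]) auto
    also have "\<dots> = 0\<^sub>v m" unfolding Av using A by (intro eq_vecI) auto
    finally have "(mat_adjoint A * A) *\<^sub>v v = 0\<^sub>v m" .
    moreover have "mat_adjoint A * A \<in> carrier_mat m m"
      using A by (intro mult_carrier_mat[of _ m n]) auto
    ultimately show ?thesis
      using det v det_0_iff_vec_prod_zero_field[of "mat_adjoint A * A" m] by auto
  qed
  \<comment> \<open>Linear dependence concerns the set of columns, which would hide a repetition.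
    Two equal columns would put a difference of unit vectors into the kernel.\<close>
  have "distinct (cols A)"
  proof (rule ccontr)
    assume "\<not> distinct (cols A)"
    then obtain i j where ij: "i < m" "j < m" "i \<noteq> j" "col A i = col A j"
      using A by (auto simp: distinct_conv_nth)
    let ?v = "unit_vec m i - unit_vec m j :: complex vec"
    have "A *\<^sub>v ?v = A *\<^sub>v unit_vec m i - A *\<^sub>v unit_vec m j"
      using A by (intro mult_minus_distrib_mat_vec[of _ n m]) auto
    also have "\<dots> = col A j - col A j" using ij by (simp add: mult_mat_unit_vec[OF A])
    also have "\<dots> = 0\<^sub>v n" using A by (intro eq_vecI) auto
    finally have "?v = 0\<^sub>v m" using ker by simp
    then have "?v $ i = 0" using ij by simp
    then show False using ij by simp
  qed
  moreover have "\<not> module.lin_dep class_ring (module_vec TYPE(complex) n) (set (cols A))"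
    using vec_space.lin_depE[OF A _ \<open>distinct (cols A)\<close>] ker by metis
  ultimately show ?thesis
    using vec_space.lin_indpt_full_rank[OF A] by simp
qed


text \<open>A lattice is closed under subtraction, so \<open>u - v\<close> is a nonzero lattice
  point and has no zero coordinate.\<close>

lemma full_div_rotated_Zn_distinct:
  assumes L: "full_div_rotated_Zn n L" and uv: "u \<in> L" "v \<in> L" "u \<noteq> v" and i: "i < n"
  shows "u $ i \<noteq> v $ i"
proof -
  obtain U where U: "U \<in> carrier_mat n n"
      and L_eq: "L = {U *\<^sub>v map_vec real_of_int z | z. z \<in> carrier_vec n}"
      and div: "\<forall>w \<in> L. w \<noteq> 0\<^sub>v n \<longrightarrow> (\<forall>i<n. w $ i \<noteq> 0)"
    using L unfolding full_div_rotated_Zn_def by blast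
  obtain a b where a: "a \<in> carrier_vec n" "u = U *\<^sub>v map_vec real_of_int a"
      and b: "b \<in> carrier_vec n" "v = U *\<^sub>v map_vec real_of_int b"
    using uv L_eq by blast
  have cu: "u \<in> carrier_vec n" "v \<in> carrier_vec n" using a b U by auto
  have "map_vec real_of_int (a - b) = map_vec real_of_int a - map_vec real_of_int b"
    using a b by (intro eq_vecI) auto
  then have "u - v = U *\<^sub>v map_vec real_of_int (a - b)"
    using a b U by (simp add: mult_minus_distrib_mat_vec[OF U])
  then have "u - v \<in> L" using a b L_eq by auto
  moreover have "u - v \<noteq> 0\<^sub>v n"
  proof
    assume "u - v = 0\<^sub>v n"
    then have "(u - v) $ k = 0" if "k < n" for k using that by simp
    then show False using cu uv(3) by (metis carrier_vecD eq_iff_diff_eq_0 eq_vecI index_minus_vec(1))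
  qed
  ultimately have "(u - v) $ i \<noteq> 0" using div i by blast
  then show ?thesis using cu i by simp
qed

section \<open>Positivity of the Gram matrix, injectivity and full diversity\<close>

lemma block_inner_self_pos:
  assumes "l < 4" "x $ (4*m+l) \<noteq> 0"
  shows "block_inner x x m > 0"
  unfolding block_inner_def using assms
  by (intro sum_pos2[of _ l]) (auto simp: zero_less_mult_iff linorder_neq_iff)

text \<open>The identity \<open>C_P_gram\<close> with equal arguments and scale 1 gives twice the
  Gram matrix.\<close>

lemma gram_C_P:
  "mat_adjoint (C_P R x) * C_P R x =
    mat_diag R (\<lambda>p. complex_of_real (block_inner x x (p div 2)))"
proof -
  let ?G = "mat_adjoint (C_P R x) * C_P R x"
  let ?D = "mat_diag R (\<lambda>p. complex_of_real (block_inner x x (p div 2)))"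
  have cG: "?G \<in> carrier_mat R R"
    by (intro mult_carrier_mat[of _ R "code_len R"]) auto
  have "?G + ?G = mat_diag R (\<lambda>p. complex_of_real (2 * block_inner x x (p div 2)))"
    using C_P_gram[of "\<lambda>_. 1" R x x] left_mult_one_mat[OF C_P_carrier[of R x]] by simp
  then have "(?G + ?G) $$ (i, j) = 2 * ?D $$ (i, j)" if "i < R" "j < R" for i j
    using that by (simp add: mat_diag_def)
  then have "?G $$ (i, j) = ?D $$ (i, j)" if "i < R" "j < R" for i j
    using that cG by (metis carrier_matD index_add_mat(1) mult_2 mult_cancel_left zero_neq_numeral)
  then show ?thesis
    using cG by (intro eq_matI) (auto simp: mat_diag_def)
qed

lemma inj_C_P:
  "inj_on (C_P R) (carrier_vec (2 * code_len R))"
proof (rule inj_onI)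
  let ?N = "code_len R"
  fix x y :: "real vec"
  assume x: "x \<in> carrier_vec (2 * ?N)" and y: "y \<in> carrier_vec (2 * ?N)"
    and eq: "C_P R x = C_P R y"
  have z: "zc x i = zc y i" if i: "i < ?N" for i
  proof -
    \<comment> \<open>Each coordinate stands unconjugated in the even column of its block. This
      column is always present, as the one dropped for odd \<open>R\<close> has the odd index
      \<open>R\<close>.\<close>
    have "2 * (i div 2) < R" using i unfolding code_len_def by (auto split: if_splits, presburger)
    then have "C_P R v $$ (i, 2 * (i div 2)) = zc v i" for v
      using i by (simp add: C_P_index)
    then show ?thesis using eq by metis
  qed
  show "x = y"
  proof (rule eq_vecI)
    fix k assume "k < dim_vec y"
    then have "k div 2 < ?N" using y by auto
    from z[OF this] show "x $ k = y $ k"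
      by (cases "even k") (auto simp: zc_def elim!: evenE oddE)
  qed (use x y in auto)
qed

lemma det_gram_C_P_diff:
  assumes lat: "\<And>l. l < 4 \<Longrightarrow> \<exists>L. full_div_rotated_Zn (code_len R div 2) L \<and> \<A> l \<subseteq> L"
    and x: "x \<in> signal_set (code_len R) \<A>" and y: "y \<in> signal_set (code_len R) \<A>"
    and neq: "x \<noteq> y"
  shows "det (mat_adjoint (C_P R x - C_P R y) * (C_P R x - C_P R y)) \<noteq> 0"
proof -
  let ?N = "code_len R"
  have xc: "x \<in> carrier_vec (2 * ?N)" and yc: "y \<in> carrier_vec (2 * ?N)"
    using x y by (auto simp: signal_set_def)
  obtain k where k: "k < 2 * ?N" "x $ k \<noteq> y $ k"
    using neq xc yc by (metis carrier_vecD eq_vecI)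
  \<comment> \<open>One differing group suffices: it has a variable in every block, and by the
    lattice property its two vectors differ in all of them.\<close>
  define l where "l = k mod 4"
  have l: "l < 4" by (simp add: l_def)
  have kdiv: "k div 4 < ?N div 2" "4 * (k div 4) + l = k"
    using k(1) even_code_len[of R] by (auto simp: l_def elim!: evenE)
  obtain L where L: "full_div_rotated_Zn (?N div 2) L" "\<A> l \<subseteq> L" using lat[OF l] by blast
  have "group_vec ?N l x $ (k div 4) \<noteq> group_vec ?N l y $ (k div 4)"
    using k kdiv by (simp add: group_vec_def)
  then have gneq: "group_vec ?N l x \<noteq> group_vec ?N l y" by auto
  have gL: "group_vec ?N l x \<in> L" "group_vec ?N l y \<in> L"
    using x y l L(2) by (auto simp: signal_set_def)
  have "block_inner (x - y) (x - y) m > 0" if m: "m < ?N div 2" for m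
  proof (rule block_inner_self_pos[OF l])
    have "4 * m + l < 2 * ?N" using m l by linarith
    moreover have "x $ (4*m+l) \<noteq> y $ (4*m+l)"
      using full_div_rotated_Zn_distinct[OF L(1) gL gneq m] m by (simp add: group_vec_def)
    ultimately show "(x - y) $ (4*m+l) \<noteq> 0" using xc yc by simp
  qed
  moreover have "p div 2 < ?N div 2" if "p < R" for p
    using that le_code_len[of R] even_code_len[of R] by (auto elim!: evenE)
  ultimately show ?thesis
    unfolding C_P_diff[OF xc yc] gram_C_P det_mat_diag by fastforce
qed

theorem mainTheorem1:
  fixes R N :: nat and \<A> :: "nat \<Rightarrow> real vec set"
  assumes R: "R \<ge> 1"
    and N: "N = code_len R"
    and fin: "\<And>l. l < 4 \<Longrightarrow> finite (\<A> l)"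
    and lat: "\<And>l. l < 4 \<Longrightarrow> \<exists>L. full_div_rotated_Zn (N div 2) L \<and> \<A> l \<subseteq> L"
  shows "has_rate N R (2*N) (C_P R) 1
    \<and> (\<forall>x \<in> signal_set N \<A>. \<forall>x' \<in> signal_set N \<A>. x \<noteq> x' \<longrightarrow>
         vec_space.rank N (C_P R x - C_P R x') = R
         \<and> det (mat_adjoint (C_P R x - C_P R x') * (C_P R x - C_P R x')) \<noteq> 0)
    \<and> (\<exists>W. group_ML_decodable N R (2*N) 4 (\<lambda>k. k mod 4) (C_P R) W
         \<and> (\<forall>(c::real) (g :: nat \<Rightarrow> complex). c > 0 \<longrightarrow>
              (let B = inv_sqrt_mat N (noise_cov N R (relay_matrix R) c g)
               in group_ML_decodable N R (2*N) 4 (\<lambda>k. k mod 4)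
                    (\<lambda>x. B * C_P R x) (\<lambda>k. B * W k))))"
proof (intro conjI ballI impI exI allI)
  show "has_rate N R (2*N) (C_P R) 1"
    using R inj_C_P[of R] le_code_len[of R] unfolding N has_rate_def by simp
  fix x y assume xy: "x \<in> signal_set N \<A>" "y \<in> signal_set N \<A>" "x \<noteq> y"
  show det: "det (mat_adjoint (C_P R x - C_P R y) * (C_P R x - C_P R y)) \<noteq> 0"
    using det_gram_C_P_diff[of R \<A> x y] lat xy N by blast
  show "vec_space.rank N (C_P R x - C_P R y) = R"
    by (rule rank_eq_dim_col_of_det_gram[OF _ det]) (simp add: N minus_carrier_mat)
next
  \<comment> \<open>This fixes the witness for the weight matrices, which the whitened code below
    must share. Scale 1 gives the code itself.\<close>
  show "group_ML_decodable N R (2*N) 4 (\<lambda>k. k mod 4) (C_P R) (\<lambda>k. C_P R (unit_vec (2*N) k))"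
    using group_ML_decodable_scaled_C_P[of R "\<lambda>_. 1"] R
    by (simp add: N left_mult_one_mat[OF C_P_carrier])
  fix c :: real and g :: "nat \<Rightarrow> complex"
  assume c: "c > 0"
  have "inv_sqrt_mat N (noise_cov N R (relay_matrix R) c g) =
      mat_diag N (\<lambda>i. complex_of_real (1 / sqrt (noise_var R c g i)))"
    unfolding N noise_cov_relay_matrix by (rule inv_sqrt_mat_diag) (rule noise_var_pos[OF c])
  \<comment> \<open>The two rows of a block see the same relays, so whitening scales them
    equally.\<close>
  moreover have "noise_var R c g (2*m) = noise_var R c g (2*m+1)" for m
    by (simp add: noise_var_def)
  ultimately show "let B = inv_sqrt_mat N (noise_cov N R (relay_matrix R) c g)
      in group_ML_decodable N R (2*N) 4 (\<lambda>k. k mod 4)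
           (\<lambda>x. B * C_P R x) (\<lambda>k. B * C_P R (unit_vec (2*N) k))"
    using group_ML_decodable_scaled_C_P[of R "\<lambda>i. 1 / sqrt (noise_var R c g i)"] R
    by (simp add: N Let_def)
qed

end
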